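(* For $1\le p\le\infty$, $$\|P'\|_p\le c\,n\,\|P\|_p,\qquad n>0,\ P\in\Pi_n.$$
   Context: $\|\cdot\|_p$ is the $L^p(\mathbb{R})$ norm with respect to Lebesgue measure. For real $n>0$, $\Pi_n$ is the set of functions on $\mathbb{R}$ of the form $x\mapsto\exp(-x^2/2)R(x)$, where $R$ is an algebraic polynomial of degree $<n^2$ (equivalently, the span of the orthonormalized Hermite functions $\psi_j$ with $\sqrt{j}<n$). $P'$ denotes the derivative of the function $P$ (including the exponential factor). $c$ denotes a generic positive constant depending only on the fixed parameters in the discussion, such as the norms (i.e., possibly on $p$).
   Formalization: The claim with one c for all real n > 0 fails as n → 0+, since exp(-x²/2) lies in every Π_n; it is proved instead for all n ≥ n₀ with arbitrary n₀ > 0 and c depending on p and n₀ (n₀ = 1 gives c depending only on p for all n ≥ 1). *)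

theory Defs
  imports
    "HOL-Probability.Essential_Supremum"
    "HOL-Computational_Algebra.Polynomial"
begin

text \<open>
  The \<open>L\<^sup>p\<close> norm on the real line, for \<open>1 \<le> p \<le> \<infinity>\<close>. It takes values in \<^typ>\<open>ennreal\<close>,
  so that it is infinite (and not a default value) for a function outside \<open>L\<^sup>p\<close>.
\<close>

definition Lp_norm :: "ennreal \<Rightarrow> (real \<Rightarrow> real) \<Rightarrow> ennreal" where
  "Lp_norm p f =
    (if p = \<infinity> then esssup lebesgue (\<lambda>x. ennreal \<bar>f x\<bar>)
     else (let I = (\<integral>\<^sup>+ x. ennreal (\<bar>f x\<bar> powr enn2real p) \<partial>lebesgue)
           in if I = \<infinity> then \<infinity> else ennreal (enn2real I powr (1 / enn2real p))))"

text \<open>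
  The index \<open>n\<close> is real. For every \<open>n\<close> with \<open>0 < n \<le> 1\<close> the set below consists of the
  multiples of the Gaussian, whose derivative is not identically zero. Hence a bound
  \<open>\<parallel>P'\<parallel> \<le> c n \<parallel>P\<parallel>\<close> cannot hold with a single \<open>c\<close> as \<open>n\<close> tends to \<open>0\<close>.
\<close>

definition weighted_polys :: "real \<Rightarrow> (real \<Rightarrow> real) set" where
  "weighted_polys n =
    {\<lambda>x. exp (- (x\<^sup>2 / 2)) * poly R x | R :: real poly. real (degree R) < n\<^sup>2}"

end

(*
  Write P(x) = exp (-x^2/2) R(x) with deg R \<le> N, and let f be the entire extension of P.
  Lagrange interpolation of R at N + 1 nodes with spacing of order 1/sqrt N in [0, 3 sqrt N], at which
  |P| \<le> exp N * \<parallel>P\<parallel>_p, gives |f(x + iy)| \<le> exp (10 N) * exp (-x^2/4) * \<parallel>P\<parallel>_p for |y| \<le> sqrt N.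
  Now pair f with a function g of dual norm 1: F(z) = \<integral> f(z + s) g(s) ds is bounded by \<parallel>P\<parallel>_p on the real
  line (Hoelder) and by exp (12 N) * \<parallel>P\<parallel>_p on the strip |Im z| \<le> sqrt N. The three lines theorem
  improves the latter to exp (12 sqrt N |Im z|) * \<parallel>P\<parallel>_p, and Cauchy's estimate on the circle of radius
  1/sqrt N gives |F'(0)| \<le> exp 12 * sqrt N * \<parallel>P\<parallel>_p. Choosing g extremal for P' concludes; for p = \<infinity>
  the function F is simply a translate of f. The loss of the factors exp (C N) is harmless because it
  occurs at height sqrt N, N times the radius of the circle.
*)
theory Submission
  imports Defs "HOL-Complex_Analysis.Conformal_Mappings"
begin

section \<open>The three lines theorem and the resulting derivative estimate\<close>

text \<open>Log-linear interpolation between the line \<open>Im w = 0\<close> (bound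
  \<open>A\<close>) and the line \<open>Im w = h\<close> (bound \<open>A * exp (lam * h)\<close>).
  The a priori bound inside the strip only serves to control the vertical sides of a rectangle to
  which the maximum modulus principle applies.\<close>

lemma three_lines_upper:
  fixes F :: "complex \<Rightarrow> complex" and A h lam :: real
  assumes holo: "F holomorphic_on UNIV"
    and lam: "0 \<le> lam"
    and real: "\<And>x. norm (F (of_real x)) \<le> A"
    and strip: "\<And>w. 0 \<le> Im w \<Longrightarrow> Im w \<le> h \<Longrightarrow> norm (F w) \<le> A * exp (lam * h)"
    and z: "0 \<le> Im z" "Im z \<le> h"
  shows "norm (F z) \<le> A * exp (lam * Im z)"
proof -
  have h: "0 \<le> h" using z by simp
  have A: "0 \<le> A" using order_trans[OF norm_ge_zero real[of 0]] .
  have main: "norm (F z) * exp (- lam * Im z) \<le> A * exp (e * (h\<^sup>2 + (Re z)\<^sup>2))" if e: "e > 0" for e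
  proof -
    \<comment> \<open>The first factor levels the two boundary lines, the Gaussian makes the vertical sides of a
      long rectangle negligible.\<close>
    define G where "G w = F w * exp (\<i> * of_real lam * w) * exp (- (of_real e * w\<^sup>2))" for w
    have nG: "norm (G w) = norm (F w) * exp (- lam * Im w) * exp (- (e * ((Re w)\<^sup>2 - (Im w)\<^sup>2)))" for w
      by (simp add: G_def norm_mult power2_eq_square)
    \<comment> \<open>The half-width keeps \<open>z\<close> inside the rectangle and gives
      \<open>e * X^2\<close> at least \<open>lam * h\<close>, so that on the vertical sides the
      Gaussian pays for the crude strip bound.\<close>
    define X where "X = \<bar>Re z\<bar> + sqrt (lam * h / e)"
    have X: "\<bar>Re z\<bar> \<le> X" using lam h e by (simp add: X_def)
    have "lam * h / e = (sqrt (lam * h / e))\<^sup>2" using lam h e by simp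
    also have "\<dots> \<le> X\<^sup>2" using lam h e unfolding X_def by (intro power_mono) auto
    finally have X2: "lam * h \<le> e * X\<^sup>2" using e by (simp add: field_simps)
    have Gh: "G holomorphic_on T" for T
      unfolding G_def by (intro holomorphic_intros holomorphic_on_subset[OF holo]) auto
    have "norm (G z) \<le> A * exp (e * h\<^sup>2)"
    proof (rule maximum_modulus_frontier[where f = G and \<xi> = z and S = "cbox (Complex (- X) 0) (Complex X h)"])
      show "z \<in> cbox (Complex (- X) 0) (Complex X h)"
        using X z by (auto simp: in_cbox_complex_iff)
    next
      fix w assume "w \<in> frontier (cbox (Complex (- X) 0) (Complex X h))"
      then have w: "0 \<le> Im w" "Im w \<le> h"
        and c: "Re w = - X \<or> Re w = X \<or> Im w = 0 \<or> Im w = h"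
        by (auto simp: frontier_cbox in_cbox_complex_iff in_box_complex_iff)
      have sq: "(Im w)\<^sup>2 \<le> h\<^sup>2" using w by (intro power_mono) auto
      consider "Re w = - X \<or> Re w = X" | "Im w = 0" | "Im w = h" using c by blast
      then show "norm (G w) \<le> A * exp (e * h\<^sup>2)"
      proof cases
        case 1
        have "norm (G w) \<le> (A * exp (lam * h)) * 1 * exp (- (e * ((Re w)\<^sup>2 - (Im w)\<^sup>2)))"
          unfolding nG using strip[OF w] lam w A by (intro mult_mono) auto
        also have "\<dots> = A * exp (lam * h - e * X\<^sup>2 + e * (Im w)\<^sup>2)"
          using 1 by (auto simp: algebra_simps mult_exp_exp)
        also have "\<dots> \<le> A * exp (e * h\<^sup>2)"
        proof -
          have "lam * h - e * X\<^sup>2 + e * (Im w)\<^sup>2 \<le> e * h\<^sup>2"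
            using X2 mult_left_mono[OF sq less_imp_le[OF e]] by linarith
          then show ?thesis using A by (intro mult_left_mono) auto
        qed
        finally show ?thesis .
      next
        case 2
        then have "w = of_real (Re w)" by (simp add: complex_eq_iff)
        then have "norm (F w) \<le> A" using real[of "Re w"] by simp
        then have "norm (G w) \<le> A * 1 * exp (e * h\<^sup>2)"
          unfolding nG using 2 A e by (intro mult_mono) (auto simp: order_trans[of _ 0])
        then show ?thesis by simp
      next
        case 3
        have "norm (G w) \<le> (A * exp (lam * h)) * exp (- lam * h) * exp (e * h\<^sup>2)"
          unfolding nG using strip[OF w] 3 A e
          by (intro mult_mono) (auto simp: right_diff_distrib)
        then show ?thesis by (simp add: mult.assoc mult_exp_exp)
      qed
    qed (use Gh in \<open>auto intro!: holomorphic_on_imp_continuous_on\<close>)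
    then have "norm (F z) * exp (- lam * Im z) * exp (- (e * ((Re z)\<^sup>2 - (Im z)\<^sup>2))) \<le> A * exp (e * h\<^sup>2)"
      by (simp add: nG)
    then have "norm (F z) * exp (- lam * Im z) * exp (- (e * ((Re z)\<^sup>2 - (Im z)\<^sup>2))) * exp (e * (Re z)\<^sup>2)
        \<le> A * exp (e * h\<^sup>2) * exp (e * (Re z)\<^sup>2)"
      by (intro mult_right_mono) auto
    moreover have "norm (F z) * exp (- lam * Im z) * 1
        \<le> norm (F z) * exp (- lam * Im z) * (exp (- (e * ((Re z)\<^sup>2 - (Im z)\<^sup>2))) * exp (e * (Re z)\<^sup>2))"
      using e unfolding mult_exp_exp by (intro mult_left_mono) (auto simp: algebra_simps)
    moreover have "A * exp (e * h\<^sup>2) * exp (e * (Re z)\<^sup>2) = A * exp (e * (h\<^sup>2 + (Re z)\<^sup>2))"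
      by (simp add: mult.assoc mult_exp_exp distrib_left)
    ultimately show ?thesis by (simp only: mult.assoc mult_1_right)
  qed
  \<comment> \<open>The rectangle has disappeared from \<open>main\<close>, so \<open>e\<close> may
    tend to 0 for fixed \<open>z\<close>.\<close>
  have "norm (F z) * exp (- lam * Im z) \<le> A * exp (0 * (h\<^sup>2 + (Re z)\<^sup>2))"
  proof (rule tendsto_lowerbound)
    show "((\<lambda>e. A * exp (e * (h\<^sup>2 + (Re z)\<^sup>2))) \<longlongrightarrow> A * exp (0 * (h\<^sup>2 + (Re z)\<^sup>2))) (at_right 0)"
      by (intro tendsto_intros)
    show "\<forall>\<^sub>F e in at_right 0. norm (F z) * exp (- lam * Im z) \<le> A * exp (e * (h\<^sup>2 + (Re z)\<^sup>2))"
      using main by (auto simp: eventually_at_filter)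
  qed simp
  then have "norm (F z) * exp (- lam * Im z) * exp (lam * Im z) \<le> A * exp (lam * Im z)"
    by (intro mult_right_mono) auto
  then show ?thesis by (simp add: mult.assoc mult_exp_exp)
qed

text \<open>With \<open>lam = c * sqrt N\<close> and height \<open>sqrt N\<close>, the three lines
  theorem turns the factor \<open>exp (c * N)\<close> into \<open>exp (c * sqrt N * |Im w|)\<close>.
  On the circle of radius \<open>1 / sqrt N\<close> this is at most \<open>exp c\<close>, and
  Cauchy's estimate adds the factor \<open>sqrt N\<close>.\<close>

lemma deriv_bound_of_strip_bound:
  fixes F :: "complex \<Rightarrow> complex" and A N c :: real
  assumes holo: "F holomorphic_on UNIV" and N: "1 \<le> N" and c: "0 \<le> c"
    and real: "\<And>x. norm (F (of_real x)) \<le> A"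
    and strip: "\<And>w. \<bar>Im w\<bar> \<le> sqrt N \<Longrightarrow> norm (F w) \<le> A * exp (c * N)"
  shows "norm (deriv F 0) \<le> exp c * sqrt N * A"
proof -
  have A: "0 \<le> A" using order_trans[OF norm_ge_zero real[of 0]] .
  have cN: "c * sqrt N * sqrt N = c * N" using N by simp
  have up: "norm (F w) \<le> A * exp (c * sqrt N * \<bar>Im w\<bar>)" if w: "\<bar>Im w\<bar> \<le> sqrt N" for w
  proof (cases "0 \<le> Im w")
    case True
    have "norm (F w) \<le> A * exp (c * sqrt N * Im w)"
      by (rule three_lines_upper[OF holo, where h = "sqrt N"]) (use N c real strip w True in \<open>auto simp: cN\<close>)
    then show ?thesis using True by simp
  next
    case False
    \<comment> \<open>The lower half of the strip follows by applying the upper half to the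
      reflected function.\<close>
    have "norm (F (- (- w))) \<le> A * exp (c * sqrt N * Im (- w))"
    proof (rule three_lines_upper[where h = "sqrt N" and F = "\<lambda>w. F (- w)"])
      show "(\<lambda>w. F (- w)) holomorphic_on UNIV"
        using holomorphic_on_compose_gen[OF _ holo, of uminus UNIV]
        by (simp add: o_def holomorphic_on_minus)
      show "norm (F (- complex_of_real x)) \<le> A" for x
        using real[of "- x"] by simp
    qed (use N c real strip w False in \<open>auto simp: cN\<close>)
    then show ?thesis using False by simp
  qed
  have sN: "1 \<le> sqrt N" using N by simp
  have "norm ((deriv ^^ 1) F 0) \<le> fact 1 * (A * exp c) / (1 / sqrt N) ^ 1"
  proof (rule Cauchy_inequality)
    fix w :: complex assume "norm (0 - w) = 1 / sqrt N"
    then have im: "\<bar>Im w\<bar> \<le> 1 / sqrt N" using abs_Im_le_cmod[of w] by simp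
    moreover have "1 / sqrt N \<le> sqrt N" using sN N by (simp add: field_simps)
    ultimately have "norm (F w) \<le> A * exp (c * sqrt N * \<bar>Im w\<bar>)" by (intro up) simp
    also have "\<dots> \<le> A * exp (c * sqrt N * (1 / sqrt N))"
      using im A c N by (intro mult_left_mono exp_le_cancel_iff[THEN iffD2] mult_nonneg_nonneg) auto
    finally show "norm (F w) \<le> A * exp c" using N by simp
  qed (use N holo in \<open>auto intro: holomorphic_on_subset intro!: holomorphic_on_imp_continuous_on\<close>)
  then show ?thesis by (simp add: mult_ac)
qed

section \<open>Lagrange interpolation and growth in the strip\<close>

text \<open>Both sides are polynomials of degree at most \<open>N\<close> that agree at
  \<open>N + 1\<close> distinct nodes.\<close>

lemma poly_eq_lagrange_sum:
  fixes R :: "'a :: field poly"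
  assumes inj: "inj_on t {..N}" and deg: "degree R \<le> N"
  shows "poly R z = (\<Sum>k\<le>N. poly R (t k) * (\<Prod>j\<in>{..N} - {k}. (z - t j) / (t k - t j)))"
proof -
  define L where "L k = (\<Prod>j\<in>{..N} - {k}. [:- t j / (t k - t j), 1 / (t k - t j):])" for k
  have pL: "poly (L k) x = (\<Prod>j\<in>{..N} - {k}. (x - t j) / (t k - t j))" for k x
    unfolding L_def poly_prod by (intro prod.cong) (auto simp: diff_divide_distrib)
  define Q where "Q = (\<Sum>k\<le>N. smult (poly R (t k)) (L k))"
  have "degree (L k) \<le> N" if "k \<le> N" for k
  proof -
    have "degree (L k) \<le> (\<Sum>j\<in>{..N} - {k}. degree [:- t j / (t k - t j), 1 / (t k - t j):])"
      unfolding L_def by (rule order_trans[OF degree_prod_sum_le]) (simp_all add: o_def)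
    also have "\<dots> \<le> (\<Sum>j\<in>{..N} - {k}. 1)"
      by (intro sum_mono) simp
    finally show ?thesis using that by simp
  qed
  then have degQ: "degree Q \<le> N"
    unfolding Q_def by (intro degree_sum_le) (auto intro: order_trans[OF degree_smult_le])
  have delta: "poly (L k) (t i) = (if k = i then 1 else 0)" if "k \<le> N" "i \<le> N" for k i
  proof (cases "k = i")
    case True
    then show ?thesis using inj that unfolding pL
      by (auto intro!: prod.neutral dest: inj_onD split: if_splits)
  next
    case False
    then show ?thesis using that unfolding pL by (auto intro!: prod_zero)
  qed
  have "R = Q"
  proof (rule poly_eqI_degree[of "t ` {..N}"])
    fix x assume "x \<in> t ` {..N}"
    then obtain i where "i \<le> N" "x = t i" by auto
    then show "poly R x = poly Q x"
      by (simp add: Q_def poly_sum delta if_distrib[of "\<lambda>c. _ * c"] cong: if_cong)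
  qed (use deg degQ inj in \<open>auto simp: card_image\<close>)
  then have "poly R z = poly Q z" by simp
  then show ?thesis by (simp add: Q_def poly_sum pL)
qed

text \<open>The Lagrange denominators for integer nodes: the distances run through 1 to
  \<open>k\<close> on the left of \<open>k\<close> and through 1 to \<open>N - k\<close> on its
  right.\<close>

lemma prod_abs_diff_eq_fact:
  assumes "k \<le> N"
  shows "(\<Prod>j\<in>{..N} - {k}. \<bar>real j - real k\<bar>) = fact k * fact (N - k)"
  using assms
proof (induction N rule: dec_induct)
  case base
  have "(\<Prod>j\<in>{..k} - {k}. \<bar>real j - real k\<bar>) = (\<Prod>j = 0..<k. real (k - j))"
    by (intro prod.cong) auto
  also have "\<dots> = fact k" by (simp add: fact_prod_rev)
  finally show ?case by simp
next
  case (step N)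
  have "{..Suc N} - {k} = insert (Suc N) ({..N} - {k})" using step by auto
  then show ?case using step by (simp add: Suc_diff_le)
qed

text \<open>The left side is a single term of the exponential series.\<close>

lemma power_div_fact_le_exp: "real n ^ n / fact n \<le> exp (real n)"
proof -
  have "(\<Sum>k\<in>{n}. real n ^ k /\<^sub>R fact k) \<le> (\<Sum>k. real n ^ k /\<^sub>R fact k)"
    by (intro sum_le_suminf summable_exp_generic) auto
  then show ?thesis by (simp add: exp_def field_simps)
qed

lemma sum_inverse_fact_products:
  "(\<Sum>k\<le>N. 1 / (fact k * fact (N - k))) = (2 ^ N / fact N :: real)"
proof -
  have "(\<Sum>k\<le>N. 1 / (fact k * fact (N - k))) = (\<Sum>k\<le>N. real (N choose k) / fact N)"
    by (intro sum.cong) (auto simp: binomial_fact)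
  also have "\<dots> = real (\<Sum>k\<le>N. N choose k) / fact N"
    by (simp add: sum_divide_distrib)
  finally show ?thesis by (simp add: choose_row_sum)
qed

text \<open>The denominators are compared with those of a lattice of spacing
  \<open>1 / sqrt N\<close>. Each numerator is at most
  \<open>5 * sqrt N * exp (x^2 / (4 * N))\<close> with \<open>x = Re z\<close>; the product of
  \<open>N\<close> such factors costs only \<open>exp (x^2 / 4)\<close>, half of the decay that the
  weight \<open>exp (- x^2 / 2)\<close> provides.\<close>

lemma norm_lagrange_weight_le:
  fixes t :: "nat \<Rightarrow> real" and z :: complex
  assumes N: "1 \<le> N" and k: "k \<le> N"
    and sep: "\<And>j. j \<le> N \<Longrightarrow> \<bar>real j - real k\<bar> / sqrt (real N) \<le> \<bar>t j - t k\<bar>"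
    and t: "\<And>j. j \<le> N \<Longrightarrow> 0 \<le> t j \<and> t j \<le> 3 * sqrt (real N)"
    and im: "\<bar>Im z\<bar> \<le> sqrt (real N)"
  shows "norm (\<Prod>j\<in>{..N} - {k}. (z - of_real (t j)) / (of_real (t k) - of_real (t j)))
    \<le> 5 ^ N * exp ((Re z)\<^sup>2 / 4) * real N ^ N / (fact k * fact (N - k))"
proof -
  define s where "s = sqrt (real N)"
  have s: "s > 0" "s\<^sup>2 = real N" using N by (simp_all add: s_def)
  define E where "E = 5 * s * exp ((Re z)\<^sup>2 / 4 / real N)"
  have bd: "norm (z - of_real (t j)) \<le> E" if "j \<le> N" for j
  proof -
    have "norm (z - of_real (t j)) \<le> norm z + \<bar>t j\<bar>"
      using norm_triangle_ineq4[of z "of_real (t j)"] by simp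
    also have "norm z \<le> \<bar>Re z\<bar> + \<bar>Im z\<bar>" by (rule cmod_le)
    also have "\<bar>Re z\<bar> + \<bar>Im z\<bar> + \<bar>t j\<bar> \<le> \<bar>Re z\<bar> + 4 * s"
      using t[OF that] im by (simp add: s_def)
    also have "\<dots> = s * (\<bar>Re z\<bar> / s + 4)" using s by (simp add: field_simps)
    also have "\<dots> \<le> s * (5 * exp ((Re z)\<^sup>2 / 4 / real N))"
    proof (intro mult_left_mono)
      define u where "u = \<bar>Re z\<bar> / s"
      have u2: "(Re z)\<^sup>2 / 4 / real N = u\<^sup>2 / 4"
        using s by (simp add: u_def power_divide)
      have "u + 4 \<le> 5 * (1 + u\<^sup>2 / 4)"
      proof -
        define w where "w = u\<^sup>2"
        have "2 * u \<le> 1 + w"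
          using zero_le_power2[of "u - 1"] by (simp add: w_def power2_eq_square algebra_simps)
        moreover have "0 \<le> w" by (simp add: w_def)
        ultimately show ?thesis unfolding w_def[symmetric] by simp
      qed
      also have "\<dots> \<le> 5 * exp (u\<^sup>2 / 4)"
        by (intro mult_left_mono exp_ge_add_one_self) auto
      finally show "\<bar>Re z\<bar> / s + 4 \<le> 5 * exp ((Re z)\<^sup>2 / 4 / real N)"
        unfolding u2 by (simp add: u_def)
    qed (use s in auto)
    finally show ?thesis by (simp add: E_def mult_ac)
  qed
  have E: "0 < E" using s by (simp add: E_def)
  have card: "card ({..N} - {k}) = N" using k by simp
  have "norm (\<Prod>j\<in>{..N} - {k}. (z - of_real (t j)) / (of_real (t k) - of_real (t j)))
      = (\<Prod>j\<in>{..N} - {k}. norm (z - of_real (t j)) / \<bar>t k - t j\<bar>)"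
    by (simp add: prod_norm[symmetric] norm_divide flip: of_real_diff)
  also have "\<dots> \<le> (\<Prod>j\<in>{..N} - {k}. E * s / \<bar>real j - real k\<bar>)"
  proof (intro prod_mono conjI)
    fix j assume j: "j \<in> {..N} - {k}"
    then have pos: "0 < \<bar>real j - real k\<bar> / s" using s by simp
    have le: "\<bar>real j - real k\<bar> / s \<le> \<bar>t k - t j\<bar>" using sep[of j] j by (simp add: s_def abs_minus_commute)
    have "norm (z - of_real (t j)) / \<bar>t k - t j\<bar> \<le> E / (\<bar>real j - real k\<bar> / s)"
      using bd[of j] j pos le E by (intro frac_le) auto
    then show "norm (z - of_real (t j)) / \<bar>t k - t j\<bar> \<le> E * s / \<bar>real j - real k\<bar>" by simp
  qed simp
  also have "\<dots> = (E * s) ^ N / (fact k * fact (N - k))"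
    using prod_abs_diff_eq_fact[OF k, symmetric] card by (simp add: prod_dividef)
  also have "(E * s) ^ N = 5 ^ N * exp ((Re z)\<^sup>2 / 4) * real N ^ N"
  proof -
    have "E * s = 5 * real N * exp ((Re z)\<^sup>2 / 4 / real N)"
      using s by (simp add: E_def power2_eq_square)
    then show ?thesis using N by (simp add: power_mult_distrib flip: exp_of_nat_mult)
  qed
  finally show ?thesis .
qed

text \<open>The exponent 9 is a sum of four costs: 9/2 for removing the weight at nodes up to
  \<open>3 * sqrt N\<close>, 3 for \<open>10 ^ N\<close>, 1 for \<open>N ^ N / fact N\<close>, and
  1/2 for the weight at height at most \<open>sqrt N\<close>. In the \<open>Re z\<close> direction,
  decay 1/2 minus growth 1/4 leaves 1/4.\<close>

lemma weighted_poly_strip_bound: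
  fixes R :: "complex poly" and t :: "nat \<Rightarrow> real" and z :: complex
  assumes N: "1 \<le> N" and deg: "degree R \<le> N"
    and sep: "\<And>j k. j \<le> N \<Longrightarrow> k \<le> N \<Longrightarrow> \<bar>real j - real k\<bar> / sqrt (real N) \<le> \<bar>t j - t k\<bar>"
    and t: "\<And>j. j \<le> N \<Longrightarrow> 0 \<le> t j \<and> t j \<le> 3 * sqrt (real N)"
    and B: "\<And>j. j \<le> N \<Longrightarrow> norm (exp (- ((of_real (t j))\<^sup>2 / 2)) * poly R (of_real (t j))) \<le> B"
    and im: "\<bar>Im z\<bar> \<le> sqrt (real N)"
  shows "norm (exp (- (z\<^sup>2 / 2)) * poly R z) \<le> B * exp (9 * real N) * exp (- ((Re z)\<^sup>2 / 4))"
proof -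
  define x where "x = Re z"
  have B0: "0 \<le> B" using B[of 0] norm_ge_zero order_trans by blast
  have Rb: "norm (poly R (of_real (t j))) \<le> B * exp (9 / 2 * real N)" if j: "j \<le> N" for j
  proof -
    have "norm (poly R (of_real (t j))) = exp ((t j)\<^sup>2 / 2) * norm (exp (- ((of_real (t j))\<^sup>2 / 2)) * poly R (of_real (t j)))"
      by (simp add: norm_mult mult_exp_exp flip: mult.assoc of_real_power)
    also have "\<dots> \<le> exp (9 / 2 * real N) * B"
    proof (intro mult_mono B j)
      have "(t j)\<^sup>2 \<le> (3 * sqrt (real N))\<^sup>2" using t[OF j] by (intro power_mono) auto
      then show "exp ((t j)\<^sup>2 / 2) \<le> exp (9 / 2 * real N)" by (simp add: power_mult_distrib)
    qed auto
    finally show ?thesis by (simp add: mult_ac)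
  qed
  have inj: "inj_on (\<lambda>j. complex_of_real (t j)) {..N}"
  proof (intro inj_onI)
    fix j k assume jk: "j \<in> {..N}" "k \<in> {..N}" "complex_of_real (t j) = complex_of_real (t k)"
    then have "\<bar>real j - real k\<bar> / sqrt (real N) \<le> 0" using sep[of j k] by simp
    then show "j = k" using N by (simp add: divide_le_0_iff)
  qed
  have "norm (poly R z) \<le> (\<Sum>k\<le>N. norm (poly R (of_real (t k)) *
      (\<Prod>j\<in>{..N} - {k}. (z - of_real (t j)) / (of_real (t k) - of_real (t j)))))"
    unfolding poly_eq_lagrange_sum[OF inj deg, of z] by (rule norm_sum)
  also have "\<dots> \<le> (\<Sum>k\<le>N. (B * exp (9 / 2 * real N)) * (5 ^ N * exp (x\<^sup>2 / 4) * real N ^ N / (fact k * fact (N - k))))"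
    unfolding norm_mult x_def
    by (intro sum_mono mult_mono Rb norm_lagrange_weight_le) (use B0 N sep t im in auto)
  also have "\<dots> = B * exp (9 / 2 * real N) * 5 ^ N * exp (x\<^sup>2 / 4) * real N ^ N * (\<Sum>k\<le>N. 1 / (fact k * fact (N - k)))"
    unfolding sum_distrib_left by (intro sum.cong) auto
  also have "\<dots> = B * exp (9 / 2 * real N) * exp (x\<^sup>2 / 4) * 10 ^ N * (real N ^ N / fact N)"
  proof -
    have "(10::real) ^ N = 5 ^ N * 2 ^ N" unfolding power_mult_distrib[symmetric] by simp
    then show ?thesis unfolding sum_inverse_fact_products by simp
  qed
  also have "\<dots> \<le> B * exp (9 / 2 * real N) * exp (x\<^sup>2 / 4) * exp (3 * real N) * exp (real N)"
  proof (intro mult_mono power_div_fact_le_exp)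
    have "(10::real) \<le> (1 + 1/2 + 1/8)^6" by (simp add: power_divide)
    also have "\<dots> \<le> exp (1/2) ^ 6"
      using exp_lower_Taylor_quadratic[of "1/2"] by (intro power_mono) (auto simp: power2_eq_square)
    also have "\<dots> = exp 3" by (simp flip: exp_of_nat_mult)
    finally have "(10::real) ^ N \<le> exp 3 ^ N" by (intro power_mono) auto
    then show "(10::real) ^ N \<le> exp (3 * real N)" by (simp add: mult.commute flip: exp_of_nat_mult)
  qed (use B0 in auto)
  finally have P: "norm (poly R z) \<le> B * exp (17 / 2 * real N) * exp (x\<^sup>2 / 4)"
    by (simp add: mult.assoc mult_exp_exp)
  have "norm (exp (- (z\<^sup>2 / 2))) \<le> exp (real N / 2 - x\<^sup>2 / 2)"
  proof -
    have "(Im z)\<^sup>2 \<le> (sqrt (real N))\<^sup>2" using im abs_le_square_iff[of "Im z" "sqrt (real N)"] by simp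
    then show ?thesis by (simp add: Re_power2 x_def power2_eq_square diff_divide_distrib)
  qed
  then have "norm (exp (- (z\<^sup>2 / 2)) * poly R z) \<le> exp (real N / 2 - x\<^sup>2 / 2) * (B * exp (17 / 2 * real N) * exp (x\<^sup>2 / 4))"
    unfolding norm_mult using P by (intro mult_mono) auto
  also have "\<dots> = B * (exp (real N / 2 - x\<^sup>2 / 2) * exp (17 / 2 * real N) * exp (x\<^sup>2 / 4))"
    by (simp only: mult_ac)
  also have "exp (real N / 2 - x\<^sup>2 / 2) * exp (17 / 2 * real N) * exp (x\<^sup>2 / 4) = exp (9 * real N) * exp (- (x\<^sup>2 / 4))"
    unfolding mult_exp_exp by (rule arg_cong[of _ _ exp]) (simp add: field_simps)
  finally show ?thesis by (simp add: x_def mult_ac)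
qed

section \<open>Averages, Hoelder's inequality and a Gaussian integral\<close>

text \<open>The minimum is at most the mean. This supplies interpolation nodes when only an integral
  of \<open>P\<close> is controlled.\<close>

lemma exists_le_integral_average:
  fixes q :: "real \<Rightarrow> real"
  assumes "a < b" "continuous_on {a..b} q"
  obtains t where "t \<in> {a..b}" "q t \<le> integral {a..b} q / (b - a)"
proof -
  obtain t where t: "t \<in> {a..b}" "\<And>y. y \<in> {a..b} \<Longrightarrow> q t \<le> q y"
    using continuous_attains_inf[of "{a..b}" q] assms by auto
  have "integral {a..b} (\<lambda>_. q t) \<le> integral {a..b} q"
    using t assms by (intro integral_le integrable_continuous_interval) auto
  then have "q t * (b - a) \<le> integral {a..b} q" using assms by (simp add: mult.commute)
  then show ?thesis using that t assms by (simp add: field_simps)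
qed

text \<open>Young's inequality for \<open>u / U\<close> and \<open>v / V\<close>, integrated.
  Writing the dual factor as \<open>v x powr (p - 1)\<close> avoids the conjugate exponent, which
  would be infinite for \<open>p = 1\<close>.\<close>

lemma holder_continuous:
  fixes u v :: "real \<Rightarrow> real"
  assumes p: "1 \<le> p" and UV: "0 < U" "0 < V"
    and cu: "continuous_on {a..b} u" and cv: "continuous_on {a..b} v"
    and u: "\<And>x. x \<in> {a..b} \<Longrightarrow> 0 \<le> u x" and v: "\<And>x. x \<in> {a..b} \<Longrightarrow> 0 < v x"
    and iu: "integral {a..b} (\<lambda>x. u x powr p) \<le> U powr p"
    and iv: "integral {a..b} (\<lambda>x. v x powr p) \<le> V powr p"
  shows "integral {a..b} (\<lambda>x. u x * v x powr (p - 1)) \<le> U * V powr (p - 1)"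
proof -
  define K where "K = U * V powr (p - 1)"
  have K: "0 < K" using UV by (simp add: K_def)
  have up: "continuous_on {a..b} (\<lambda>x. u x powr p)"
    using cu u p by (intro continuous_on_powr' continuous_intros) auto
  have vp: "continuous_on {a..b} (\<lambda>x. v x powr r)" for r
    using cv v by (intro continuous_on_powr continuous_intros) (auto simp: less_imp_neq[symmetric])
  have young: "u x * v x powr (p - 1) \<le> K * (u x powr p / (p * U powr p) + (1 - 1/p) * v x powr p / V powr p)"
    if x: "x \<in> {a..b}" for x
  proof (cases "u x = 0")
    case True
    then show ?thesis using K p UV v[OF x] by (simp add: zero_le_mult_iff divide_nonneg_nonneg)
  next
    case False
    then have u0: "0 < u x" using u[OF x] by simp
    have "((u x / U) powr p) powr (1/p) * ((v x / V) powr p) powr (1 - 1/p)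
        \<le> (1/p) * (u x / U) powr p + (1 - 1/p) * (v x / V) powr p"
      using u0 v[OF x] UV p by (intro Youngs_inequality_0) auto
    also have "((u x / U) powr p) powr (1/p) = u x / U"
      using u0 UV p by (simp add: powr_powr)
    also have "((v x / V) powr p) powr (1 - 1/p) = (v x / V) powr (p - 1)"
      using p by (simp add: powr_powr right_diff_distrib)
    finally have "K * (u x / U * (v x / V) powr (p - 1)) \<le> K * ((1/p) * (u x / U) powr p + (1 - 1/p) * (v x / V) powr p)"
      using K by (intro mult_left_mono) auto
    moreover have "K * (u x / U * (v x / V) powr (p - 1)) = u x * v x powr (p - 1)"
      using UV v[OF x] by (simp add: K_def powr_divide)
    ultimately show ?thesis using u0 v[OF x] UV by (simp add: powr_divide)
  qed
  have "integral {a..b} (\<lambda>x. u x * v x powr (p - 1))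
      \<le> integral {a..b} (\<lambda>x. K * (u x powr p / (p * U powr p) + (1 - 1/p) * v x powr p / V powr p))"
    using p UV by (intro integral_le integrable_continuous_interval continuous_intros cu up vp young) auto
  also have "\<dots> = K * (integral {a..b} (\<lambda>x. u x powr p) / (p * U powr p)
      + (1 - 1/p) * integral {a..b} (\<lambda>x. v x powr p) / V powr p)"
    unfolding integral_mult_right
    using p UV by (subst integral_add) (auto simp: mult.assoc intro!: integrable_continuous_interval up vp
        continuous_on_divide continuous_on_mult continuous_on_const)
  also have "\<dots> \<le> K * (U powr p / (p * U powr p) + (1 - 1/p) * V powr p / V powr p)"
    using iu iv p K UV by (intro mult_left_mono add_mono divide_right_mono) auto
  also have "\<dots> = K" using UV p by simp
  finally show ?thesis by (simp add: K_def)
qed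

text \<open>The integrand is at most \<open>1 / (1 + s^2 / 4)\<close>, whose integral over the whole
  line is \<open>2 * pi\<close>.\<close>

lemma integral_gaussian_le:
  fixes a b :: real
  shows "integral {a..b} (\<lambda>s. exp (- (s\<^sup>2 / 4))) \<le> 7"
proof (cases "a \<le> b")
  case True
  have "((\<lambda>s. 2 * arctan (s / 2)) has_vector_derivative 1 / (1 + s\<^sup>2 / 4)) (at s within {a..b})" for s
  proof -
    have "((\<lambda>s. 2 * arctan (s / 2)) has_real_derivative 2 * (inverse (1 + (s / 2)\<^sup>2) * (1 / 2))) (at s within {a..b})"
      by (intro DERIV_cmult DERIV_chain2[where g = "\<lambda>s. s / 2"] DERIV_arctan DERIV_cdivide DERIV_ident)
    moreover have "2 * (inverse y * (1 / 2)) = 1 / y" for y :: real by (cases "y = 0") (simp_all add: field_simps)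
    moreover have "(s / 2)\<^sup>2 = s\<^sup>2 / 4" by (simp add: power_divide)
    ultimately show ?thesis
      by (simp only: has_real_derivative_iff_has_vector_derivative)
  qed
  then have I: "((\<lambda>s. 1 / (1 + s\<^sup>2 / 4)) has_integral (2 * arctan (b / 2) - 2 * arctan (a / 2))) {a..b}"
    by (intro fundamental_theorem_of_calculus True) auto
  have nz: "1 + s\<^sup>2 / 4 > 0" for s :: real by (simp add: add_pos_nonneg)
  have "integral {a..b} (\<lambda>s. exp (- (s\<^sup>2 / 4))) \<le> integral {a..b} (\<lambda>s. 1 / (1 + s\<^sup>2 / 4))"
  proof (intro integral_le integrable_continuous_interval continuous_intros)
    fix s :: real
    have "1 + s\<^sup>2 / 4 \<le> exp (s\<^sup>2 / 4)" by (rule exp_ge_add_one_self)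
    then show "exp (- (s\<^sup>2 / 4)) \<le> 1 / (1 + s\<^sup>2 / 4)"
      using nz[of s] by (simp add: exp_minus inverse_eq_divide frac_le)
  qed (use nz in \<open>auto simp: less_imp_neq[symmetric]\<close>)
  also have "\<dots> = 2 * arctan (b / 2) - 2 * arctan (a / 2)" using I by (rule integral_unique)
  also have "\<dots> \<le> 2 * (pi / 2) + 2 * (pi / 2)"
    using arctan_ubound[of "b/2"] arctan_lbound[of "a/2"] by simp
  also have "\<dots> \<le> 7" using pi_less_4 pi_approx by simp
  finally show ?thesis .
qed simp

section \<open>From bounds in the strip to Bernstein inequalities on the line\<close>

lemma real_derivative_continuous_of_entire:
  fixes f :: "complex \<Rightarrow> complex" and P u :: "real \<Rightarrow> real"
  assumes holo: "f holomorphic_on UNIV"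
    and fP: "\<And>x. f (of_real x) = of_real (P x)"
    and u: "\<And>x. (P has_real_derivative u x) (at x)"
  shows "deriv f (of_real x) = of_real (u x)" and "continuous_on S u"
proof -
  show deriv: "deriv f (of_real x) = of_real (u x)" for x
  proof (rule vector_derivative_unique_at)
    show "((\<lambda>x. f (of_real x)) has_vector_derivative deriv f (of_real x)) (at x)"
      using holo by (intro has_vector_derivative_real_field holomorphic_derivI[of f UNIV]) auto
    show "((\<lambda>x. f (of_real x)) has_vector_derivative of_real (u x)) (at x)"
      unfolding fP by (intro has_vector_derivative_of_real u)
  qed
  have "continuous_on UNIV (deriv f)"
    using holo by (intro holomorphic_on_imp_continuous_on holomorphic_deriv) auto
  then have "continuous_on S (\<lambda>x. deriv f (of_real x))"
    by (rule continuous_on_compose2) (auto intro: continuous_intros)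
  then have "continuous_on S (\<lambda>x. Re (deriv f (of_real x)))"
    by (rule continuous_on_Re)
  then show "continuous_on S u" by (simp add: deriv)
qed

text \<open>Absorbs the Gaussian mass 7 into the exponential, which raises the exponent from
  \<open>10 * N\<close> to \<open>12 * N\<close>.\<close>

lemma seven_le_exp:
  fixes N :: real
  assumes N: "1 \<le> N"
  shows "7 \<le> exp (2 * N)"
proof -
  have "(7::real) \<le> (1 + 1/4 + 1/32)^8" by (simp add: power_divide)
  also have "\<dots> \<le> exp (1/4) ^ 8"
    using exp_lower_Taylor_quadratic[of "1/4"] by (intro power_mono) (auto simp: power2_eq_square)
  also have "\<dots> = exp 2" by (simp flip: exp_of_nat_mult)
  also have "\<dots> \<le> exp (2 * N)" using N by simp
  finally show ?thesis .
qed

lemma Linf_bernstein_of_strip_bound: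
  fixes f :: "complex \<Rightarrow> complex" and P u :: "real \<Rightarrow> real" and N U :: real
  assumes holo: "f holomorphic_on UNIV"
    and fP: "\<And>x. f (of_real x) = of_real (P x)"
    and u: "\<And>x. (P has_real_derivative u x) (at x)"
    and N: "1 \<le> N"
    and strip: "\<And>z. \<bar>Im z\<bar> \<le> sqrt N \<Longrightarrow> norm (f z) \<le> U * exp (10 * N) * exp (- ((Re z)\<^sup>2 / 4))"
    and bound: "\<And>x. \<bar>P x\<bar> \<le> U"
  shows "\<bar>u x\<bar> \<le> exp 12 * sqrt N * U"
proof -
  have U: "0 \<le> U" using order_trans[OF abs_ge_zero bound[of 0]] .
  define F where "F z = f (of_real x + z)" for z
  have F': "(F has_field_derivative deriv f (of_real x + z)) (at z)" for z
    unfolding F_def add.commute[of "of_real x"]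
    by (intro DERIV_shift[THEN iffD1] holomorphic_derivI[OF holo]) auto
  have "norm (deriv F 0) \<le> exp 12 * sqrt N * U"
  proof (rule deriv_bound_of_strip_bound[OF _ N])
    show "F holomorphic_on UNIV"
      using F' by (auto simp: holomorphic_on_def field_differentiable_def)
    show "norm (F (of_real y)) \<le> U" for y
      using bound[of "x + y"] by (simp add: F_def fP flip: of_real_add)
    show "norm (F w) \<le> U * exp (12 * N)" if w: "\<bar>Im w\<bar> \<le> sqrt N" for w
    proof -
      have "norm (F w) \<le> U * exp (10 * N) * exp (- ((x + Re w)\<^sup>2 / 4))"
        using strip[of "of_real x + w"] w by (simp add: F_def)
      also have "\<dots> \<le> U * exp (12 * N) * 1"
        using U N by (intro mult_mono) auto
      finally show ?thesis by simp
    qed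
  qed simp
  moreover have "deriv F 0 = of_real (u x)"
    using DERIV_imp_deriv[OF F'[of 0]] real_derivative_continuous_of_entire(1)[OF holo fP u] by simp
  ultimately show ?thesis by simp
qed

text \<open>Duality on a compact interval, where all integrands are continuous. The hypothesis
  \<open>int\<close> ranges over all intervals because the pairing function \<open>F\<close> on the
  real line involves translates of \<open>P\<close>.\<close>

lemma Lp_bernstein_of_strip_bound:
  fixes f :: "complex \<Rightarrow> complex" and P u :: "real \<Rightarrow> real" and p N U M :: real
  assumes holo: "f holomorphic_on UNIV"
    and fP: "\<And>x. f (of_real x) = of_real (P x)"
    and u: "\<And>x. (P has_real_derivative u x) (at x)"
    and N: "1 \<le> N" and p: "1 \<le> p" and U: "0 < U"
    and strip: "\<And>z. \<bar>Im z\<bar> \<le> sqrt N \<Longrightarrow> norm (f z) \<le> U * exp (10 * N) * exp (- ((Re z)\<^sup>2 / 4))"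
    and int: "\<And>a b. integral {a..b} (\<lambda>x. \<bar>P x\<bar> powr p) \<le> U powr p"
  shows "integral {-M..M} (\<lambda>x. \<bar>u x\<bar> powr p) \<le> (exp 12 * sqrt N * U) powr p"
proof (cases "0 < M")
  case False
  then have "{-M..M} = {} \<or> {-M..M} = {M}" by force
  then have "integral {-M..M} (\<lambda>x. \<bar>u x\<bar> powr p) = 0" by auto
  then show ?thesis by simp
next
  case M: True
  define K where "K = exp 12 * sqrt N * U"
  have K: "0 < K" using U N by (simp add: K_def)
  \<comment> \<open>The \<open>p\<close>-norm of the constant 1 on \<open>{-M..M}\<close>; it
    measures the error caused by the regularization below.\<close>
  define L where "L = (2 * M) powr (1 / p)"
  have L: "0 < L" using M by (simp add: L_def)
  have cu: "continuous_on S u" and du: "deriv f (of_real x) = of_real (u x)" for S x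
    using real_derivative_continuous_of_entire[OF holo fP u] by auto
  have cP: "continuous_on S P" for S
    using u by (intro continuous_at_imp_continuous_on) (auto intro: DERIV_isCont)
  have cf: "continuous_on S f" for S
    using holo holomorphic_on_imp_continuous_on continuous_on_subset by blast
  have cdf: "continuous_on S (deriv f)" for S
    using holo by (intro holomorphic_on_imp_continuous_on holomorphic_on_subset[OF holomorphic_deriv[of f UNIV]]) auto
  have main: "integral {-M..M} (\<lambda>x. \<bar>u x\<bar> powr p) \<le> (K + e * L) powr p" if e: "0 < e" for e
  proof -
    \<comment> \<open>A majorant of \<open>|u|\<close> bounded below by \<open>e\<close>: positivity
      keeps \<open>v x powr (p - 2)\<close> continuous even for \<open>p < 2\<close>.\<close>
    define v where "v x = sqrt ((u x)\<^sup>2 + e\<^sup>2)" for x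
    have v2: "(v x)\<^sup>2 = (u x)\<^sup>2 + e\<^sup>2" for x by (simp add: v_def)
    have ve: "e \<le> v x" for x using e by (simp add: v_def real_le_rsqrt)
    have vu: "\<bar>u x\<bar> \<le> v x" for x unfolding v_def by (rule real_le_rsqrt) simp
    have v0: "0 < v x" for x using ve[of x] e by simp
    have cv: "continuous_on S v" for S unfolding v_def by (intro continuous_intros cu)
    have cvp: "continuous_on S (\<lambda>x. v x powr r)" for S r
      using v0 by (intro continuous_on_powr cv continuous_on_const) (auto simp: less_imp_neq[symmetric])
    \<comment> \<open>A continuous substitute for the extremal function \<open>sgn u * \<bar>u\<bar> powr (p - 1)\<close>, which for \<open>p = 1\<close>
      jumps at the zeros of \<open>u\<close>: continuity is needed to differentiate under the integral sign.\<close>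
    define g where "g x = u x * v x powr (p - 2)" for x
    have cg: "continuous_on S g" for S unfolding g_def by (intro continuous_intros cu cvp)
    have vp1: "v x powr (p - 1) = v x * v x powr (p - 2)" for x
      using powr_add[of "v x" 1 "p - 2"] v0[of x] by simp
    have vp: "v x powr p = v x * v x powr (p - 1)" for x
      using powr_add[of "v x" 1 "p - 1"] v0[of x] by simp
    have gv: "\<bar>g x\<bar> \<le> v x powr (p - 1)" for x
      unfolding g_def vp1 abs_mult using vu[of x] by (intro mult_mono) auto
    define I where "I = integral {-M..M} (\<lambda>x. v x powr p)"
    have "integral {-M..M} (\<lambda>x. e powr p) \<le> I"
      unfolding I_def using ve e p by (intro integral_le integrable_continuous_interval cvp powr_mono2) auto
    moreover have "0 < integral {-M..M} (\<lambda>x. e powr p)" using M e by simp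
    ultimately have I0: "0 < I" by linarith
    define V where "V = I powr (1 / p)"
    have V: "0 < V" "V powr p = I" using I0 p by (simp_all add: V_def powr_powr)
    have VV: "V powr p = V * V powr (p - 1)"
      using powr_add[of V 1 "p - 1"] V(1) by simp
    have holder: "integral {-M..M} (\<lambda>x. w x * v x powr (p - 1)) \<le> W * V powr (p - 1)"
      if "0 < W" "continuous_on {-M..M} w" "\<And>x. 0 \<le> w x" "integral {-M..M} (\<lambda>x. w x powr p) \<le> W powr p" for w W
      using that p V v0 cv by (intro holder_continuous) (auto simp: I_def)
    define F where "F z = integral (cbox (-M) M) (\<lambda>s. f (z + of_real s) * of_real (g s))" for z
    have F': "(F has_field_derivative integral (cbox (-M) M) (\<lambda>s. deriv f (z + of_real s) * of_real (g s))) (at z)" for z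
      unfolding F_def
    proof (rule leibniz_rule_field_derivative[where U = UNIV])
      show "((\<lambda>z. f (z + of_real s) * of_real (g s)) has_field_derivative deriv f (z + of_real s) * of_real (g s)) (at z)" for z s
        by (intro DERIV_cmult_right DERIV_shift[THEN iffD1] holomorphic_derivI[OF holo]) auto
      show "(\<lambda>s. f (z + of_real s) * of_real (g s)) integrable_on cbox (-M) M" for z
        by (intro integrable_continuous continuous_intros continuous_on_compose2[OF cf[of UNIV]] cg) auto
      show "continuous_on (UNIV \<times> cbox (-M) M) (\<lambda>(z, s). deriv f (z + of_real s) * of_real (g s))"
        unfolding case_prod_beta
        by (intro continuous_intros continuous_on_compose2[OF cdf[of UNIV]] continuous_on_compose2[OF cg[of UNIV]]) auto
    qed auto
    have Fbound: "norm (F z) \<le> integral {-M..M} (\<lambda>s. w s * v s powr (p - 1))"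
      if "continuous_on {-M..M} w" "\<And>s. norm (f (z + of_real s)) \<le> w s" for w z
      unfolding F_def cbox_interval
    proof (rule integral_norm_bound_integral)
      show "norm (f (z + of_real s) * of_real (g s)) \<le> w s * v s powr (p - 1)" for s
        unfolding norm_mult norm_of_real by (intro mult_mono that gv) (use order_trans[OF norm_ge_zero that(2)] in auto)
      show "(\<lambda>s. f (z + of_real s) * of_real (g s)) integrable_on {-M..M}"
        by (intro integrable_continuous_interval continuous_intros continuous_on_compose2[OF cf[of UNIV]] cg) auto
      show "(\<lambda>s. w s * v s powr (p - 1)) integrable_on {-M..M}"
        by (intro integrable_continuous_interval continuous_intros that cvp)
    qed
    have "norm (deriv F 0) \<le> exp 12 * sqrt N * (U * V powr (p - 1))"
    proof (rule deriv_bound_of_strip_bound[OF _ N])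
      show "F holomorphic_on UNIV"
        using F' by (auto simp: holomorphic_on_def field_differentiable_def)
      show "norm (F (of_real x)) \<le> U * V powr (p - 1)" for x
      proof -
        have "norm (F (of_real x)) \<le> integral {-M..M} (\<lambda>s. \<bar>P (x + s)\<bar> * v s powr (p - 1))"
          by (intro Fbound continuous_intros continuous_on_compose2[OF cP[of UNIV]])
            (auto simp: fP simp flip: of_real_add)
        also have "\<dots> \<le> U * V powr (p - 1)"
        proof (intro holder U continuous_intros continuous_on_compose2[OF cP[of UNIV]])
          show "integral {-M..M} (\<lambda>s. \<bar>P (x + s)\<bar> powr p) \<le> U powr p"
            using integral_shift_Icc_real[of "-M" M "\<lambda>s. \<bar>P s\<bar> powr p" x] int by (simp add: o_def)
        qed auto
        finally show ?thesis .
      qed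
      show "norm (F w) \<le> U * V powr (p - 1) * exp (12 * N)" if w: "\<bar>Im w\<bar> \<le> sqrt N" for w
      proof -
        let ?G = "\<lambda>s. exp (- ((Re w + s)\<^sup>2 / 4))"
        have "norm (F w) \<le> integral {-M..M} (\<lambda>s. U * exp (10 * N) * ?G s * v s powr (p - 1))"
        proof (intro Fbound continuous_intros)
          show "norm (f (w + of_real s)) \<le> U * exp (10 * N) * ?G s" for s
            using strip[of "w + of_real s"] w by simp
        qed auto
        also have "\<dots> = U * exp (10 * N) * integral {-M..M} (\<lambda>s. ?G s * v s powr (p - 1))"
          by (simp add: mult.assoc)
        also have "\<dots> \<le> U * exp (10 * N) * (7 * V powr (p - 1))"
        proof (intro mult_left_mono holder continuous_intros)
          \<comment> \<open>Since \<open>?G\<close> is at most 1 and \<open>p\<close> at least 1,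
            raising to the power \<open>p\<close> only decreases it; so its \<open>p\<close>-norm is
            at most 7 for every \<open>p\<close>.\<close>
          have "integral {-M..M} (\<lambda>s. ?G s powr p) \<le> integral {-M..M} ?G"
          proof (intro integral_le integrable_continuous_interval continuous_intros)
            fix s
            have "?G s powr p \<le> ?G s powr 1" using p by (intro powr_mono') auto
            then show "?G s powr p \<le> ?G s" by simp
          qed auto
          also have "\<dots> \<le> 7"
            using integral_shift_Icc_real[of "-M" M "\<lambda>s. exp (- (s\<^sup>2 / 4))" "Re w"] integral_gaussian_le
            by (simp add: o_def)
          also have "\<dots> \<le> 7 powr p" using powr_mono[of 1 p "7::real"] p by simp
          finally show "integral {-M..M} (\<lambda>s. ?G s powr p) \<le> 7 powr p" .
        qed (use U in auto)
        also have "\<dots> \<le> U * exp (10 * N) * (exp (2 * N) * V powr (p - 1))"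
          using U seven_le_exp[OF N] by (intro mult_left_mono mult_right_mono) auto
        also have "\<dots> = U * V powr (p - 1) * exp (12 * N)"
          by (simp add: mult_exp_exp mult_ac)
        finally show ?thesis .
      qed
    qed simp
    moreover have "deriv F 0 = of_real (integral {-M..M} (\<lambda>s. u s * g s))"
    proof -
      have "deriv F 0 = integral {-M..M} (\<lambda>s. of_real (u s * g s))"
        using DERIV_imp_deriv[OF F'[of 0]] by (simp add: du)
      also have "\<dots> = of_real (integral {-M..M} (\<lambda>s. u s * g s))"
        using integral_linear[OF integrable_continuous_interval[OF continuous_on_mult[OF cu cg]]
            bounded_linear_of_real[where 'a = complex]]
        by (simp add: o_def)
      finally show ?thesis .
    qed
    ultimately have ug: "integral {-M..M} (\<lambda>s. u s * g s) \<le> K * V powr (p - 1)"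
      by (simp add: K_def mult.assoc)
    \<comment> \<open>As \<open>u^2 = v^2 - e^2\<close> and \<open>e \<le> v\<close>, the product
      \<open>u * g\<close> is at least \<open>v powr p - e * v powr (p - 1)\<close>. Thus
      \<open>g\<close> is extremal up to an error of order \<open>e\<close>.\<close>
    have "I - e * integral {-M..M} (\<lambda>s. v s powr (p - 1)) = integral {-M..M} (\<lambda>s. v s powr p - e * v s powr (p - 1))"
      unfolding I_def
      by (subst integral_diff) (auto intro!: integrable_continuous_interval continuous_on_mult continuous_on_const cvp)
    also have "\<dots> \<le> integral {-M..M} (\<lambda>s. u s * g s)"
    proof (intro integral_le integrable_continuous_interval continuous_on_diff continuous_on_mult
        continuous_on_const cvp cu cg)
      fix s
      have "u s * g s = ((v s)\<^sup>2 - e\<^sup>2) * v s powr (p - 2)"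
        using v2[of s] by (simp add: g_def power2_eq_square)
      also have "\<dots> = v s powr p - e * (e * v s powr (p - 2))"
        unfolding vp vp1 by (simp add: power2_eq_square algebra_simps)
      also have "\<dots> \<ge> v s powr p - e * v s powr (p - 1)"
        unfolding vp1 using ve[of s] e by (intro diff_mono mult_left_mono mult_right_mono) auto
      finally show "v s powr p - e * v s powr (p - 1) \<le> u s * g s" .
    qed
    also note ug
    finally have "I \<le> K * V powr (p - 1) + e * integral {-M..M} (\<lambda>s. v s powr (p - 1))" by simp
    moreover have "integral {-M..M} (\<lambda>s. 1 * v s powr (p - 1)) \<le> L * V powr (p - 1)"
      using M p by (intro holder L) (auto simp: L_def powr_powr)
    then have "e * integral {-M..M} (\<lambda>s. v s powr (p - 1)) \<le> e * (L * V powr (p - 1))"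
      using e by (intro mult_left_mono) auto
    \<comment> \<open>Cancelling \<open>V powr (p - 1)\<close>, positive because
      \<open>v \<ge> e\<close> on an interval of positive length, leaves a bound on the
      \<open>p\<close>-norm \<open>V\<close> of \<open>v\<close>.\<close>
    ultimately have "V * V powr (p - 1) \<le> (K + e * L) * V powr (p - 1)"
      unfolding VV[symmetric] V(2) distrib_right mult.assoc by (rule order_trans[OF _ add_left_mono])
    then have "V \<le> K + e * L" using V by simp
    then have "I \<le> (K + e * L) powr p"
      unfolding V(2)[symmetric] using V p by (intro powr_mono2) auto
    moreover have "integral {-M..M} (\<lambda>x. \<bar>u x\<bar> powr p) \<le> I"
      unfolding I_def using p vu
      by (intro integral_le integrable_continuous_interval cvp powr_mono2 continuous_on_powr' continuous_intros cu) auto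
    ultimately show ?thesis by simp
  qed
  have "integral {-M..M} (\<lambda>x. \<bar>u x\<bar> powr p) \<le> (K + 0 * L) powr p"
  proof (rule tendsto_lowerbound)
    show "((\<lambda>e. (K + e * L) powr p) \<longlongrightarrow> (K + 0 * L) powr p) (at_right 0)"
      using K by (intro tendsto_intros) auto
    show "\<forall>\<^sub>F e in at_right 0. integral {-M..M} (\<lambda>x. \<bar>u x\<bar> powr p) \<le> (K + e * L) powr p"
      using main by (auto simp: eventually_at_filter)
  qed simp
  then show ?thesis by (simp add: K_def)
qed

section \<open>Choice of nodes and the inequality for weighted polynomials\<close>

lemma complex_poly_of_real_poly:
  fixes R :: "real poly"
  obtains C :: "complex poly" where "degree C \<le> degree R" "\<And>x. poly C (of_real x) = of_real (poly R x)"
proof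
  show "degree (map_poly complex_of_real R) \<le> degree R"
    by (intro degree_le) (auto simp: coeff_map_poly coeff_eq_0)
  show "poly (map_poly complex_of_real R) (of_real x) = of_real (poly R x)" for x
    by (induction R) (auto simp: map_poly_pCons)
qed

lemma weighted_poly_has_real_derivative:
  "((\<lambda>x. exp (- (x\<^sup>2 / 2)) * poly R x) has_real_derivative
    exp (- (x\<^sup>2 / 2)) * (poly (pderiv R) x - x * poly R x)) (at x)"
  by (auto intro!: derivative_eq_intros poly_DERIV simp: algebra_simps)

text \<open>
  The gaps between the intervals keep nodes chosen in them \<open>1 / sqrt N\<close>-separated.
\<close>

lemma weighted_poly_strip_bound_of_local:
  fixes R :: "complex poly" and z :: complex and U :: real
  assumes N: "1 \<le> N" and deg: "degree R \<le> N"
    and node: "\<And>k. k \<le> N \<Longrightarrow> \<exists>t \<in> {2 * real k / sqrt (real N)..(2 * real k + 1) / sqrt (real N)}.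
      norm (exp (- ((of_real t)\<^sup>2 / 2)) * poly R (of_real t)) \<le> U * exp (real N)"
    and im: "\<bar>Im z\<bar> \<le> sqrt (real N)"
  shows "norm (exp (- (z\<^sup>2 / 2)) * poly R z) \<le> U * exp (10 * real N) * exp (- ((Re z)\<^sup>2 / 4))"
proof -
  define s where "s = sqrt (real N)"
  have s: "0 < s" using N by (simp add: s_def)
  have ss: "s * s = real N" by (simp add: s_def)
  from node have "\<forall>k. \<exists>t. k \<le> N \<longrightarrow> t \<in> {2 * real k / s..(2 * real k + 1) / s} \<and>
      norm (exp (- ((of_real t)\<^sup>2 / 2)) * poly R (of_real t)) \<le> U * exp (real N)"
    unfolding s_def by blast
  then obtain t where t: "\<And>k. k \<le> N \<Longrightarrow> t k \<in> {2 * real k / s..(2 * real k + 1) / s}"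
    and tb: "\<And>k. k \<le> N \<Longrightarrow> norm (exp (- ((of_real (t k))\<^sup>2 / 2)) * poly R (of_real (t k))) \<le> U * exp (real N)"
    by metis
  have sep: "\<bar>real j - real k\<bar> / s \<le> \<bar>t j - t k\<bar>" if "k < j" "j \<le> N" for j k
  proof -
    \<comment> \<open>The gap from the right end of interval \<open>k\<close> to the left end of
      interval \<open>j\<close> is \<open>2 * (j - k) - 1\<close> units, at least
      \<open>j - k\<close> since \<open>k < j\<close>.\<close>
    have "real j - real k \<le> 2 * real j - (2 * real k + 1)" using that by simp
    then have "(real j - real k) / s \<le> (2 * real j - (2 * real k + 1)) / s"
      using s by (intro divide_right_mono) auto
    also have "\<dots> \<le> t j - t k"
      using t[of j] t[of k] that by (simp add: diff_divide_distrib)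
    finally show ?thesis using that by simp
  qed
  have "norm (exp (- (z\<^sup>2 / 2)) * poly R z) \<le> U * exp (real N) * exp (9 * real N) * exp (- ((Re z)\<^sup>2 / 4))"
  proof (rule weighted_poly_strip_bound[OF N deg, where t = t])
    show "\<bar>real j - real k\<bar> / sqrt (real N) \<le> \<bar>t j - t k\<bar>" if "j \<le> N" "k \<le> N" for j k
    proof (cases j k rule: linorder_cases)
      case less
      then show ?thesis using sep[of j k] that by (simp add: s_def abs_minus_commute)
    next
      case greater
      then show ?thesis using sep[of k j] that by (simp add: s_def)
    qed simp
    show "0 \<le> t j \<and> t j \<le> 3 * sqrt (real N)" if "j \<le> N" for j
    proof
      show "0 \<le> t j" using t[OF that] s by (auto intro: order_trans[rotated])
      have "t j \<le> (2 * real j + 1) / s" using t[OF that] by simp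
      \<comment> \<open>Uses \<open>2 * j + 1 \<le> 2 * N + 1 \<le> 3 * N\<close>, valid because
        \<open>N \<ge> 1\<close>.\<close>
      also have "\<dots> \<le> 3 * real N / s" using s that N by (intro divide_right_mono) auto
      also have "\<dots> = 3 * s" using s by (simp add: ss[symmetric])
      finally show "t j \<le> 3 * sqrt (real N)" by (simp add: s_def)
    qed
  qed (use tb im in auto)
  then show ?thesis by (simp add: mult.assoc mult_exp_exp)
qed

lemma Linf_bernstein_weighted_poly:
  fixes R :: "real poly"
  assumes N: "1 \<le> N" and deg: "degree R \<le> N"
    and bound: "\<And>x. \<bar>exp (- (x\<^sup>2 / 2)) * poly R x\<bar> \<le> U"
  shows "\<bar>exp (- (x\<^sup>2 / 2)) * (poly (pderiv R) x - x * poly R x)\<bar> \<le> exp 12 * sqrt (real N) * U"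
proof -
  have U: "0 \<le> U" using order_trans[OF abs_ge_zero bound[of 0]] .
  obtain C :: "complex poly" where C: "degree C \<le> degree R" "\<And>x. poly C (of_real x) = of_real (poly R x)"
    using complex_poly_of_real_poly by blast
  define f where "f z = exp (- (z\<^sup>2 / 2)) * poly C z" for z
  have fP: "f (of_real x) = of_real (exp (- (x\<^sup>2 / 2)) * poly R x)" for x
    by (simp add: f_def C flip: exp_of_real)
  show ?thesis
  proof (rule Linf_bernstein_of_strip_bound[OF _ fP weighted_poly_has_real_derivative])
    show "f holomorphic_on UNIV" unfolding f_def by (intro holomorphic_intros) auto
    show "norm (f z) \<le> U * exp (10 * real N) * exp (- ((Re z)\<^sup>2 / 4))" if "\<bar>Im z\<bar> \<le> sqrt (real N)" for z
      unfolding f_def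
    proof (rule weighted_poly_strip_bound_of_local[OF N _ _ that])
      fix k
      \<comment> \<open>Under a uniform bound every point qualifies as a node; the left end of the
        interval is taken.\<close>
      have "norm (f (of_real (2 * real k / sqrt (real N)))) \<le> U * 1"
        unfolding fP norm_of_real using bound by simp
      also have "\<dots> \<le> U * exp (real N)" using U by (intro mult_left_mono) auto
      finally show "\<exists>t \<in> {2 * real k / sqrt (real N)..(2 * real k + 1) / sqrt (real N)}.
          norm (exp (- ((of_real t)\<^sup>2 / 2)) * poly C (of_real t)) \<le> U * exp (real N)"
        unfolding f_def by (intro bexI) (auto intro: divide_right_mono)
    qed (use C deg in auto)
  qed (use N bound in auto)
qed

text \<open>On an interval of length \<open>1 / sqrt N\<close> the mean of \<open>|P| powr p\<close>
  is at most \<open>U powr p * sqrt N\<close>, hence at most \<open>(U * sqrt N) powr p\<close>.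
  Some point of it therefore satisfies \<open>|P| \<le> U * sqrt N \<le> U * exp N\<close>, as the
  strip bound requires of a node.\<close>

lemma Lp_bernstein_weighted_poly:
  fixes R :: "real poly"
  assumes N: "1 \<le> N" and deg: "degree R \<le> N" and p: "1 \<le> p" and U: "0 < U"
    and int: "\<And>a b. integral {a..b} (\<lambda>x. \<bar>exp (- (x\<^sup>2 / 2)) * poly R x\<bar> powr p) \<le> U powr p"
  shows "integral {-M..M} (\<lambda>x. \<bar>exp (- (x\<^sup>2 / 2)) * (poly (pderiv R) x - x * poly R x)\<bar> powr p)
    \<le> (exp 12 * sqrt (real N) * U) powr p"
proof -
  obtain C :: "complex poly" where C: "degree C \<le> degree R" "\<And>x. poly C (of_real x) = of_real (poly R x)"
    using complex_poly_of_real_poly by blast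
  define f where "f z = exp (- (z\<^sup>2 / 2)) * poly C z" for z
  have fP: "f (of_real x) = of_real (exp (- (x\<^sup>2 / 2)) * poly R x)" for x
    by (simp add: f_def C flip: exp_of_real)
  have s: "1 \<le> sqrt (real N)" using N by simp
  show ?thesis
  proof (rule Lp_bernstein_of_strip_bound[OF _ fP weighted_poly_has_real_derivative])
    show "f holomorphic_on UNIV" unfolding f_def by (intro holomorphic_intros) auto
    show "norm (f z) \<le> U * exp (10 * real N) * exp (- ((Re z)\<^sup>2 / 4))" if "\<bar>Im z\<bar> \<le> sqrt (real N)" for z
      unfolding f_def
    proof (rule weighted_poly_strip_bound_of_local[OF N _ _ that])
      fix k
      let ?a = "2 * real k / sqrt (real N)" and ?b = "(2 * real k + 1) / sqrt (real N)"
      let ?q = "\<lambda>x. \<bar>exp (- (x\<^sup>2 / 2)) * poly R x\<bar> powr p"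
      have ab: "?a < ?b" "?b - ?a = 1 / sqrt (real N)"
        using s N by (auto intro: divide_strict_right_mono simp: diff_divide_distrib[symmetric])
      obtain t where t: "t \<in> {?a..?b}" "?q t \<le> integral {?a..?b} ?q / (?b - ?a)"
      proof (rule exists_le_integral_average[OF ab(1)])
        show "continuous_on {?a..?b} ?q"
          using p by (intro continuous_on_powr' continuous_intros) auto
      qed
      note t(2)
      also have "integral {?a..?b} ?q / (?b - ?a) \<le> U powr p / (1 / sqrt (real N))"
        unfolding ab(2) using int s by (intro divide_right_mono) auto
      also have "\<dots> = U powr p * sqrt (real N) powr 1" using N by simp
      also have "\<dots> \<le> U powr p * sqrt (real N) powr p"
        using s p by (intro mult_left_mono powr_mono) auto
      also have "\<dots> = (U * sqrt (real N)) powr p" using U by (simp add: powr_mult)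
      finally have "\<not> (U * sqrt (real N)) powr p < \<bar>exp (- (t\<^sup>2 / 2)) * poly R t\<bar> powr p"
        by (simp add: not_less)
      then have "\<bar>exp (- (t\<^sup>2 / 2)) * poly R t\<bar> \<le> U * sqrt (real N)"
      proof (rule contrapos_np)
        assume "\<not> \<bar>exp (- (t\<^sup>2 / 2)) * poly R t\<bar> \<le> U * sqrt (real N)"
        then show "(U * sqrt (real N)) powr p < \<bar>exp (- (t\<^sup>2 / 2)) * poly R t\<bar> powr p"
          using p U by (intro powr_less_mono2) auto
      qed
      also have "\<dots> \<le> U * exp (real N)"
      proof (intro mult_left_mono)
        have "sqrt (real N) \<le> sqrt (real N) * sqrt (real N)"
          using mult_left_mono[OF s, of "sqrt (real N)"] by simp
        also have "\<dots> = real N" by simp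
        also have "\<dots> \<le> exp (real N)" using exp_ge_add_one_self[of "real N"] by linarith
        finally show "sqrt (real N) \<le> exp (real N)" .
      qed (use U in simp)
      finally have "norm (f (of_real t)) \<le> U * exp (real N)"
        unfolding fP norm_of_real .
      then show "\<exists>t \<in> {?a..?b}. norm (exp (- ((of_real t)\<^sup>2 / 2)) * poly C (of_real t)) \<le> U * exp (real N)"
        unfolding f_def using t(1) by blast
    qed (use C deg in auto)
  qed (use N p U int in auto)
qed

section \<open>Passage to the Lebesgue norms\<close>

text \<open>By continuity the exceptional set is open, and a nonempty open set is not
  negligible.\<close>

lemma abs_le_of_AE_lebesgue:
  fixes P :: "real \<Rightarrow> real"
  assumes cont: "continuous_on UNIV P" and ae: "AE x in lebesgue. \<bar>P x\<bar> \<le> U"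
  shows "\<bar>P x\<bar> \<le> U"
proof (rule ccontr)
  assume x: "\<not> \<bar>P x\<bar> \<le> U"
  have op: "open {y. U < \<bar>P y\<bar>}"
    using cont by (intro open_Collect_less continuous_intros) auto
  from ae obtain S where S: "{y. \<not> \<bar>P y\<bar> \<le> U} \<subseteq> S" "S \<in> null_sets lebesgue"
    by (auto simp: eventually_ae_filter)
  then have neg: "negligible S" by (simp add: negligible_iff_null_sets)
  obtain e where e: "0 < e" "ball x e \<subseteq> {y. U < \<bar>P y\<bar>}"
    using op x by (auto simp: open_contains_ball not_le)
  have "negligible (ball x e)"
    using neg e S by (intro negligible_subset[OF neg]) (auto simp: not_le)
  then show False using e(1) by (simp add: negligible_convex_interior)
qed

lemma ennreal_integral_eq_nn_integral_Icc:
  fixes q :: "real \<Rightarrow> real"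
  assumes "continuous_on {a..b} q" "\<And>x. 0 \<le> q x"
  shows "ennreal (integral {a..b} q) = (\<integral>\<^sup>+ x \<in> {a..b}. ennreal (q x) \<partial>lebesgue)"
  using assms nn_integral_has_integral_lebesgue'[of "{a..b}" q "integral {a..b} q"]
  by (simp add: nn_integral_completion integrable_integral integrable_continuous_interval)

text \<open>Monotone convergence along the intervals \<open>{- real i..real i}\<close>.\<close>

lemma nn_integral_lebesgue_le_of_intervals:
  fixes q :: "real \<Rightarrow> real"
  assumes cont: "continuous_on UNIV q" and nn: "\<And>x. 0 \<le> q x"
    and le: "\<And>M. integral {-M..M} q \<le> B"
  shows "(\<integral>\<^sup>+ x. ennreal (q x) \<partial>lebesgue) \<le> ennreal B"
proof -
  define F where "F i x = ennreal (q x) * indicator {- real i..real i} x" for i :: nat and x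
  have qb: "q \<in> borel_measurable borel" using cont by (rule borel_measurable_continuous_onI)
  have sup: "(SUP i. F i x) = ennreal (q x)" for x
  proof (rule antisym)
    show "(SUP i. F i x) \<le> ennreal (q x)"
      by (intro SUP_least) (auto simp: F_def indicator_def)
    obtain i :: nat where "\<bar>x\<bar> \<le> real i" using real_arch_simple by blast
    then have "F i x = ennreal (q x)" by (auto simp: F_def indicator_def abs_le_iff)
    then show "ennreal (q x) \<le> (SUP i. F i x)" by (metis SUP_upper UNIV_I)
  qed
  have "(\<integral>\<^sup>+ x. ennreal (q x) \<partial>lebesgue) = (\<integral>\<^sup>+ x. (SUP i. F i x) \<partial>lborel)"
    by (simp add: sup nn_integral_completion)
  also have "\<dots> = (SUP i. integral\<^sup>N lborel (F i))"
  proof (rule nn_integral_monotone_convergence_SUP)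
    show "incseq F"
      by (auto simp: incseq_def le_fun_def F_def indicator_def)
    show "F i \<in> borel_measurable lborel" for i
      unfolding F_def using qb by measurable
  qed
  also have "\<dots> \<le> ennreal B"
  proof (rule SUP_least)
    fix i
    have "integral\<^sup>N lborel (F i) = ennreal (integral {- real i..real i} q)"
      unfolding F_def
      by (subst ennreal_integral_eq_nn_integral_Icc)
        (use cont nn in \<open>auto simp: nn_integral_completion intro: continuous_on_subset\<close>)
    also have "\<dots> \<le> ennreal B" using le by (intro ennreal_leI) auto
    finally show "integral\<^sup>N lborel (F i) \<le> ennreal B" .
  qed
  finally show ?thesis .
qed

lemma Lp_norm_deriv_le:
  fixes R :: "real poly" and p :: ennreal
  assumes p: "1 \<le> p" and N: "1 \<le> N" and deg: "degree R \<le> N"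
  defines "P \<equiv> \<lambda>x. exp (- (x\<^sup>2 / 2)) * poly R x"
  shows "Lp_norm p (deriv P) \<le> ennreal (exp 12 * sqrt (real N)) * Lp_norm p P"
proof -
  define u where "u x = exp (- (x\<^sup>2 / 2)) * (poly (pderiv R) x - x * poly R x)" for x
  define K where "K = exp 12 * sqrt (real N)"
  have K: "0 < K" using N by (simp add: K_def)
  have du: "deriv P = u"
    unfolding P_def u_def using DERIV_imp_deriv[OF weighted_poly_has_real_derivative] by blast
  have cP: "continuous_on S P" and cu: "continuous_on S u" for S
    unfolding P_def u_def by (intro continuous_intros; simp)+
  have "Lp_norm p u \<le> ennreal K * Lp_norm p P"
  proof (cases "p = \<infinity>")
    case True
    define E where "E = esssup lebesgue (\<lambda>x. ennreal \<bar>P x\<bar>)"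
    have n: "Lp_norm p P = E" "Lp_norm p u = esssup lebesgue (\<lambda>x. ennreal \<bar>u x\<bar>)"
      by (simp_all add: Lp_norm_def True E_def)
    show ?thesis
    proof (cases "E = \<infinity>")
      case True
      \<comment> \<open>Positivity of \<open>K\<close> matters here: in \<open>ennreal\<close> the
        product of 0 and infinity is 0.\<close>
      then show ?thesis using K by (simp add: n ennreal_mult_top)
    next
      case False
      then obtain U where U: "E = ennreal U" "0 \<le> U" by (cases E) auto
      have "AE x in lebesgue. ennreal \<bar>P x\<bar> \<le> ennreal U"
        using esssup_AE[of "\<lambda>x. ennreal \<bar>P x\<bar>" lebesgue] by (simp add: E_def[symmetric] U)
      then have "AE x in lebesgue. \<bar>P x\<bar> \<le> U" by (simp add: U)
      then have "\<bar>P x\<bar> \<le> U" for x using cP by (intro abs_le_of_AE_lebesgue)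
      then have "\<bar>u x\<bar> \<le> K * U" for x
        unfolding u_def K_def P_def by (intro Linf_bernstein_weighted_poly[OF N deg])
      moreover have "(\<lambda>x. ennreal \<bar>u x\<bar>) \<in> borel_measurable lebesgue"
        using borel_measurable_continuous_onI[OF cu] by (intro measurable_completion) simp
      ultimately have "esssup lebesgue (\<lambda>x. ennreal \<bar>u x\<bar>) \<le> ennreal (K * U)"
        by (intro esssup_I) (auto intro: ennreal_leI)
      then show ?thesis using K U by (simp add: n ennreal_mult)
    qed
  next
    case False
    define r where "r = enn2real p"
    have pr: "p = ennreal r" using False by (simp add: r_def less_top)
    have r: "1 \<le> r" using p unfolding pr by (simp add: ennreal_le_iff2 flip: ennreal_1)
    define I where "I f = (\<integral>\<^sup>+ x. ennreal (\<bar>f x\<bar> powr r) \<partial>lebesgue)" for f :: "real \<Rightarrow> real"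
    have n: "Lp_norm p f = (if I f = \<infinity> then \<infinity> else ennreal (enn2real (I f) powr (1 / r)))" for f
      using False by (simp add: Lp_norm_def I_def r_def Let_def)
    have cq: "continuous_on S (\<lambda>x. \<bar>f x\<bar> powr r)" if "continuous_on S f" for S and f :: "real \<Rightarrow> real"
      using r by (intro continuous_on_powr' continuous_intros that) auto
    show ?thesis
    proof (cases "I P = \<infinity>")
      case True
      then show ?thesis using K by (simp add: n ennreal_mult_top)
    next
      case IP: False
      then obtain J where J: "I P = ennreal J" "0 \<le> J" by (cases "I P") auto
      define U where "U = J powr (1 / r)"
      have U: "0 \<le> U" "U powr r = J" using J r by (simp_all add: U_def powr_powr)
      have int: "integral {a..b} (\<lambda>x. \<bar>P x\<bar> powr r) \<le> J" for a b
      proof -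
        have "ennreal (integral {a..b} (\<lambda>x. \<bar>P x\<bar> powr r))
            = (\<integral>\<^sup>+ x \<in> {a..b}. ennreal (\<bar>P x\<bar> powr r) \<partial>lebesgue)"
          by (intro ennreal_integral_eq_nn_integral_Icc cq cP) auto
        also have "\<dots> \<le> I P"
          unfolding I_def by (intro nn_integral_mono) (auto simp: indicator_def)
        finally show ?thesis using J by simp
      qed
      have le: "integral {-M..M} (\<lambda>x. \<bar>u x\<bar> powr r) \<le> (K * U) powr r" for M
      proof -
        \<comment> \<open>\<open>U\<close> may be 0, whereas
          \<open>Lp_bernstein_weighted_poly\<close> assumes a positive bound; it is applied to
          \<open>U + e\<close>, and \<open>e\<close> tends to 0.\<close>
        have "integral {-M..M} (\<lambda>x. \<bar>u x\<bar> powr r) \<le> (K * (U + 0)) powr r"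
        proof (rule tendsto_lowerbound)
          show "((\<lambda>e. (K * (U + e)) powr r) \<longlongrightarrow> (K * (U + 0)) powr r) (at_right 0)"
            using r U K by (intro tendsto_powr' tendsto_intros)
              (auto simp: eventually_at_filter)
          have "integral {-M..M} (\<lambda>x. \<bar>u x\<bar> powr r) \<le> (K * (U + e)) powr r" if e: "0 < e" for e
            unfolding u_def K_def
          proof (rule Lp_bernstein_weighted_poly[OF N deg r])
            fix a b
            have "J \<le> (U + e) powr r"
              unfolding U(2)[symmetric] using U(1) e r by (intro powr_mono2) auto
            then show "integral {a..b} (\<lambda>x. \<bar>exp (- (x\<^sup>2 / 2)) * poly R x\<bar> powr r) \<le> (U + e) powr r"
              using int[of a b] by (simp add: P_def)
          qed (use U e in auto)
          then show "\<forall>\<^sub>F e in at_right 0. integral {-M..M} (\<lambda>x. \<bar>u x\<bar> powr r) \<le> (K * (U + e)) powr r"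
            by (auto simp: eventually_at_filter)
        qed simp
        then show ?thesis by simp
      qed
      have "I u \<le> ennreal ((K * U) powr r)"
        unfolding I_def by (intro nn_integral_lebesgue_le_of_intervals cq cu le) auto
      then obtain J' where J': "I u = ennreal J'" "0 \<le> J'" "J' \<le> (K * U) powr r"
        by (cases "I u") (auto simp: top_unique)
      have "J' powr (1 / r) \<le> ((K * U) powr r) powr (1 / r)"
        using J' r by (intro powr_mono2) auto
      also have "\<dots> = K * U" using r K U by (simp add: powr_powr)
      finally have "ennreal (J' powr (1 / r)) \<le> ennreal K * ennreal U"
        using K U by (simp add: ennreal_mult[symmetric])
      then show ?thesis using J J' by (simp add: n U_def)
    qed
  qed
  then show ?thesis by (simp add: du K_def)
qed

theorem corollary5p1:
  fixes p :: ennreal and n\<^sub>0 :: real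
  assumes "1 \<le> p" and "0 < n\<^sub>0"
  shows "\<exists>c::real. c > 0 \<and>
    (\<forall>n::real. n \<ge> n\<^sub>0 \<longrightarrow>
      (\<forall>P \<in> weighted_polys n. Lp_norm p (deriv P) \<le> ennreal (c * n) * Lp_norm p P))"
\<comment> \<open>The natural factor is \<open>max 1 n\<close>, as the degree bound \<open>N\<close>
  below is kept at least 1. For \<open>n\<close> at least \<open>n\<^sub>0\<close> it is at most
  \<open>max 1 (1 / n\<^sub>0) * n\<close>.\<close>
proof (intro exI[of _ "exp 12 * max 1 (1 / n\<^sub>0)"] conjI allI impI ballI)
  fix n :: real and P
  assume n: "n\<^sub>0 \<le> n" and "P \<in> weighted_polys n"
  then obtain R where P: "P = (\<lambda>x. exp (- (x\<^sup>2 / 2)) * poly R x)" and deg: "real (degree R) < n\<^sup>2"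
    by (auto simp: weighted_polys_def)
  define N where "N = max 1 (degree R)"
  have n0: "0 < n" using n assms by simp
  have "1 \<le> max 1 (1 / n\<^sub>0) * n"
  proof -
    have "1 \<le> 1 / n\<^sub>0 * n" using n assms by simp
    also have "\<dots> \<le> max 1 (1 / n\<^sub>0) * n" using n0 by (intro mult_right_mono) auto
    finally show ?thesis .
  qed
  moreover have "1 * n \<le> max 1 (1 / n\<^sub>0) * n" using n0 by (intro mult_right_mono) auto
  moreover have "sqrt (real N) \<le> max 1 n"
  proof (rule real_le_lsqrt)
    show "real N \<le> (max 1 n)\<^sup>2"
    proof -
      have "n\<^sup>2 \<le> (max 1 n)\<^sup>2" "1 \<le> (max 1 n)\<^sup>2"
        using n0 by (auto intro: power_mono one_le_power)
      then show ?thesis using deg by (simp add: N_def of_nat_max)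
    qed
  qed auto
  ultimately have "sqrt (real N) \<le> max 1 (1 / n\<^sub>0) * n" by simp
  then have "ennreal (exp 12 * sqrt (real N)) \<le> ennreal (exp 12 * max 1 (1 / n\<^sub>0) * n)"
    by (intro ennreal_leI) simp
  moreover have "Lp_norm p (deriv P) \<le> ennreal (exp 12 * sqrt (real N)) * Lp_norm p P"
    unfolding P using assms(1) by (intro Lp_norm_deriv_le) (auto simp: N_def)
  ultimately show "Lp_norm p (deriv P) \<le> ennreal (exp 12 * max 1 (1 / n\<^sub>0) * n) * Lp_norm p P"
    by (meson mult_right_mono order_trans zero_le)
qed simp

end
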